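(* Let $k\geq 2$ be an integer, let $G$ be a connected graph for which $cc_{k}(G)$ exists, and let $H$ be a subdivision of $G$. Then $cc_{k}(H)$ exists and $cc_{k}(H)\leq cc_{k}(G)$.
   Context: All graphs are finite, simple and undirected. Subdividing an edge $uv$ means deleting it and adding a new vertex $w$ with edges $uw$ and $wv$; a subdivision of $G$ is any graph obtained from $G$ by a finite sequence of edge subdivisions. An edge-coloring (not necessarily proper) of a graph is $k$-color connecting if between every pair of distinct vertices there is a path whose edges use at least $k$ different colors. $cc_{k}(G)$ is the minimum number of colors of a $k$-color connecting edge-coloring of $G$ (it does not exist if there is none). *)

theory Defs
  imports "Graph_Theory.Graph_Theory"
begin

text \<open>
  Finite simple graphs are the library's \<^locale>\<open>pair_graph\<close>: finite, loop-free, symmetric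
  sets of ordered pairs. The undirected edge joining \<open>u\<close> and \<open>v\<close>, represented there by the two
  arcs \<open>(u, v)\<close> and \<open>(v, u)\<close>, is the set \<open>{u, v}\<close>. Colorings are functions on these sets, so
  that both arcs of an edge get the same color; only the values on edges of the graph matter.
\<close>

definition undirected :: "'a \<times> 'a \<Rightarrow> 'a set" where
  "undirected e = {fst e, snd e}"

definition edges :: "'a pair_pre_digraph \<Rightarrow> 'a set set" where
  "edges G = undirected ` parcs G"

text \<open>In \<open>apath u p v\<close>, \<open>p\<close> is the list of arcs of a walk with no repeated vertex.\<close>

definition color_connecting ::
    "nat \<Rightarrow> 'a pair_pre_digraph \<Rightarrow> ('a set \<Rightarrow> nat) \<Rightarrow> bool" where
  "color_connecting k G c \<longleftrightarrow>
     (\<forall>u \<in> pverts G. \<forall>v \<in> pverts G. u \<noteq> v \<longrightarrow>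
        (\<exists>p. pre_digraph.apath (with_proj G) u p v \<and> card (c ` undirected ` set p) \<ge> k))"

definition cc_exists :: "nat \<Rightarrow> 'a pair_pre_digraph \<Rightarrow> bool" where
  "cc_exists k G \<longleftrightarrow> (\<exists>c. color_connecting k G c)"

text \<open>
  The number of colors of a coloring is the number of colors it uses on the edges of the graph.
  Natural numbers suffice as colors because the graphs are finite. The value of \<open>cc k G\<close> is only
  meaningful if \<open>cc_exists k G\<close>.
\<close>

definition cc :: "nat \<Rightarrow> 'a pair_pre_digraph \<Rightarrow> nat" where
  "cc k G = (LEAST n. \<exists>c. color_connecting k G c \<and> card (c ` edges G) = n)"

end

theory Submission
  imports Defs
begin

text \<open>
  One subdivision step suffices: let both halves of a subdivided edge inherit its color. Paths
  between old vertices keep their sets of colors. For the new vertex \<open>w\<close> on the edge \<open>{a, b}\<close> and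
  an old vertex \<open>x \<noteq> a\<close>, take a path from \<open>a\<close> to \<open>x\<close> with enough colors. It uses \<open>{a, b}\<close> at most
  as its first edge, which can then be replaced by the half \<open>{w, b}\<close> of the same color;
  otherwise \<open>{w, a}\<close> can be prepended.
\<close>

lemma undirected_swap: "undirected (snd e, fst e) = undirected e"
  by (auto simp: undirected_def)

lemma undirected_rev_path: "undirected ` set (rev_path p) = undirected ` set p"
  by (induction p) (auto simp: undirected_swap)

text \<open>Like its analogue for colorings below, this makes the orientation of the subdivided edge
  irrelevant, so either end can serve as \<open>fst e\<close>.\<close>

lemma subdivide_swap: "subdivide G (snd e, fst e) w = subdivide G e w"
  by (cases e) (simp add: subdivide.simps insert_commute)

text \<open>For a fresh vertex \<open>w\<close>, the edges of the subdivided graph that contain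
  \<open>w\<close> are exactly the two halves of \<open>e\<close>.\<close>

definition subdivide_coloring :: "'a \<times> 'a \<Rightarrow> 'a \<Rightarrow> ('a set \<Rightarrow> nat) \<Rightarrow> 'a set \<Rightarrow> nat" where
  "subdivide_coloring e w c s = (if w \<in> s then c (undirected e) else c s)"

lemma subdivide_coloring_swap:
  "subdivide_coloring (snd e, fst e) w c = subdivide_coloring e w c"
  by (simp add: subdivide_coloring_def fun_eq_iff undirected_swap)

text \<open>\<open>sd_path\<close> replaces each traversal of \<open>e\<close>, in either direction,
  by the two halves, which both carry the color of \<open>e\<close>. All other arcs avoid
  \<open>w\<close> and keep their color.\<close>

lemma subdivide_coloring_sd_path:
  assumes "w \<notin> fst ` set p" "w \<notin> snd ` set p"
  shows "subdivide_coloring e w c ` undirected ` set (sd_path e w p) = c ` undirected ` set p"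
  using assms
proof (induction p)
  case Nil
  then show ?case by (cases e) simp
next
  case (Cons f p)
  then show ?case
    by (cases e) (auto simp: subdivide_coloring_def undirected_def insert_commute)
qed

lemma (in pair_wf_digraph) subdivide_coloring_edges:
  assumes "e \<in> parcs G" "w \<notin> pverts G"
  shows "subdivide_coloring e w c ` edges (subdivide G e w) \<subseteq> c ` edges G"
proof
  obtain a b where e: "e = (a, b)" by (cases e)
  fix y assume "y \<in> subdivide_coloring e w c ` edges (subdivide G e w)"
  then obtain f where f: "f \<in> parcs (subdivide G e w)"
    and y: "y = subdivide_coloring e w c (undirected f)"
    by (auto simp: edges_def)
  show "y \<in> c ` edges G"
  proof (cases "w \<in> undirected f")
    case True
    with y assms(1) show ?thesis by (auto simp: subdivide_coloring_def edges_def)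
  next
    case False
    with f have "f \<in> parcs G"
      by (auto simp: e undirected_def)
    with False y show ?thesis by (auto simp: subdivide_coloring_def edges_def)
  qed
qed

lemma (in pair_wf_digraph) apath_avoids_non_vertex:
  assumes "apath u p v" "w \<notin> pverts G"
  shows "w \<notin> fst ` set p" "w \<notin> snd ` set p"
  using assms by (auto simp: apath_def awalk_def dest: arc_fst_in_verts arc_snd_in_verts)

text \<open>Only an inclusion of color sets is possible: prepending a half of \<open>e\<close> may
  add the color of \<open>e\<close> to those of \<open>p\<close>.\<close>

lemma (in pair_bidirected_digraph) apath_from_subdividing_vertex:
  assumes e: "e \<in> parcs G" and w: "w \<notin> pverts G"
    and p: "apath (fst e) p x" and x: "fst e \<noteq> x"
  shows "\<exists>q. pre_digraph.apath (with_proj (subdivide G e w)) w q x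
    \<and> c ` undirected ` set p \<subseteq> subdivide_coloring e w c ` undirected ` set q"
proof -
  obtain a b where ab: "e = (a, b)" by (cases e)
  interpret S: pair_bidirected_digraph "subdivide G e w"
    using e w by (rule pair_bidirected_digraph_subdivide)
  have neq: "a \<noteq> b" "w \<noteq> a" "w \<noteq> b"
    using e w pair_no_loops[OF e] by (auto simp: ab dest: wellformed')
  have sd: "S.apath a (sd_path e w p) x"
    using apath_sd_path[OF p e w] by (simp add: ab)
  note colors = subdivide_coloring_sd_path[OF apath_avoids_non_vertex[OF p w], of e c]
  obtain f p' where f: "p = f # p'"
    using p x by (cases p) (auto simp: apath_Nil_iff)
  show ?thesis
  proof (cases "f = e")
    case True
    \<comment> \<open>The subdivided path without its first arc \<open>(a, w)\<close>. No color is
      lost, since \<open>(w, b)\<close> has the same color as \<open>(a, w)\<close>.\<close>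
    let ?q = "(w, b) # sd_path e w p'"
    have sdp: "sd_path e w p = (a, w) # ?q"
      by (simp add: f True ab)
    then have "S.apath w ?q x"
      using sd by (simp add: S.apath_Cons_iff)
    moreover have "subdivide_coloring e w c ` undirected ` set (sd_path e w p)
        = subdivide_coloring e w c ` undirected ` set ?q"
      by (simp add: sdp subdivide_coloring_def undirected_def)
    ultimately show ?thesis using colors by (intro exI[of _ ?q]) simp
  next
    case False
    \<comment> \<open>The path never returns to \<open>a\<close>, so neither orientation of
      \<open>e\<close> occurs after the first arc. Hence \<open>p\<close> survives the subdivision
      unchanged and misses \<open>w\<close>.\<close>
    have a: "fst f = a" "a \<notin> set (pawalk_verts (snd f) p')" and p': "awalk (snd f) p' x"
      using p by (auto simp: f ab apath_Cons_iff dest: awalkI_apath)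
    have "a \<notin> fst ` set p'" "a \<notin> snd ` set p'"
      using a(2) by (simp_all add: set_awalk_verts[OF p'])
    then have "(a, b) \<notin> set p'" "(b, a) \<notin> set p'"
      by force+
    with False neq a(1) have "(a, b) \<notin> set p" "(b, a) \<notin> set p"
      by (cases f; auto simp: f ab)+
    then have id: "sd_path e w p = p"
      by (simp add: ab sd_path_id)
    have "w \<notin> set (pawalk_verts a p)"
      using p w awalk_verts_in_verts by (auto simp: ab apath_def)
    moreover have "(w, a) \<in> parcs (subdivide G e w)"
      by (simp add: ab)
    ultimately have "S.apath w ((w, a) # p) x"
      using sd by (simp add: id S.apath_Cons_iff)
    then show ?thesis using colors by (intro exI[of _ "(w, a) # p"]) (auto simp: id)
  qed
qed

lemma (in pair_bidirected_digraph) color_connecting_subdivide: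
  assumes e: "e \<in> parcs G" and w: "w \<notin> pverts G" and cc: "color_connecting k G c"
  shows "color_connecting k (subdivide G e w) (subdivide_coloring e w c)"
proof -
  interpret S: pair_bidirected_digraph "subdivide G e w"
    using e w by (rule pair_bidirected_digraph_subdivide)
  let ?c = "subdivide_coloring e w c"
  have path: "\<exists>p. apath x p y \<and> k \<le> card (c ` undirected ` set p)"
    if "x \<in> pverts G" "y \<in> pverts G" "x \<noteq> y" for x y
    using cc that unfolding color_connecting_def by blast
  have new: "\<exists>q. S.apath w q x \<and> k \<le> card (?c ` undirected ` set q)" if x: "x \<in> pverts G" for x
  proof -
    \<comment> \<open>The two ends of \<open>e\<close> are distinct, so \<open>e\<close> can be
      oriented to start at an end other than \<open>x\<close>.\<close>
    have "\<exists>e' \<in> {e, (snd e, fst e)}. fst e' \<noteq> x"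
      using pair_no_loops[OF e] by auto
    then obtain e' where e': "e' = e \<or> e' = (snd e, fst e)" "fst e' \<noteq> x" by blast
    have arc: "e' \<in> parcs G"
      using e e' by (auto intro: arcs_symmetric)
    have eq: "subdivide G e' w = subdivide G e w" "subdivide_coloring e' w c = ?c"
      using e' by (auto simp: subdivide_swap subdivide_coloring_swap)
    obtain p where p: "apath (fst e') p x" "k \<le> card (c ` undirected ` set p)"
      using path[OF arc_fst_in_verts[OF arc] x e'(2)] by blast
    obtain q where q: "S.apath w q x" "c ` undirected ` set p \<subseteq> ?c ` undirected ` set q"
      using apath_from_subdividing_vertex[OF arc w p(1) e'(2), of c] unfolding eq by blast
    have "card (c ` undirected ` set p) \<le> card (?c ` undirected ` set q)"
      using q(2) by (intro card_mono) auto
    with p(2) q(1) show ?thesis by (meson le_trans)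
  qed
  show ?thesis
    unfolding color_connecting_def
  proof (intro ballI impI)
    fix x y
    assume xy: "x \<in> pverts (subdivide G e w)" "y \<in> pverts (subdivide G e w)" "x \<noteq> y"
    then consider "x = w" "y \<in> pverts G" | "y = w" "x \<in> pverts G" | "x \<in> pverts G" "y \<in> pverts G"
      by auto
    then show "\<exists>p. S.apath x p y \<and> k \<le> card (?c ` undirected ` set p)"
    proof cases
      case 1
      then show ?thesis using new by blast
    next
      case 2
      then obtain q where "S.apath w q x" "k \<le> card (?c ` undirected ` set q)"
        using new by blast
      with 2 show ?thesis
        by (intro exI[of _ "rev_path q"]) (simp add: undirected_rev_path)
    next
      case 3
      then obtain p where p: "apath x p y" "k \<le> card (c ` undirected ` set p)"
        using path xy(3) by blast
      have "S.apath x (sd_path e w p) y"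
        using apath_sd_path[OF p(1) e w] .
      then show ?thesis
        using p(2) subdivide_coloring_sd_path[OF apath_avoids_non_vertex[OF p(1) w], of e c]
        by (intro exI[of _ "sd_path e w p"]) simp
    qed
  qed
qed

text \<open>Induction over the subdivision steps. Inclusion of the sets of used colors composes
  along the steps and yields the bound on their number at the end.\<close>

lemma color_connecting_subdivision:
  assumes "subdivision_pair G H" "pair_graph G" "color_connecting k G c"
  shows "\<exists>c'. color_connecting k H c' \<and> c' ` edges H \<subseteq> c ` edges G"
  using assms(1)
proof (induction rule: subdivision_pair_induct)
  case base
  then show ?case using assms(3) by blast
next
  case (divide e w H)
  interpret H: pair_bidirected_digraph H
    using divide(3) by (rule bidirected_digraphI_subdivision)
  obtain c' where c': "color_connecting k H c'" "c' ` edges H \<subseteq> c ` edges G"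
    using divide.IH by blast
  show ?case
    using H.color_connecting_subdivide[OF divide(1,2) c'(1)]
      H.subdivide_coloring_edges[OF divide(1,2), of c'] c'(2)
    by (meson order_trans)
qed

theorem theorem2p2:
  fixes k :: nat and G H :: "'a pair_pre_digraph"
  assumes "k \<ge> 2"
    and "pair_graph G"
    and "connected (with_proj G)"
    and "cc_exists k G"
    and "subdivision_pair G H"
  shows "cc_exists k H \<and> cc k H \<le> cc k G"
proof -
  interpret G: pair_graph G by fact
  \<comment> \<open>Existence of a coloring ensures that the \<open>LEAST\<close> in
    \<open>cc\<close> is attained, so \<open>c\<close> below can be taken optimal.\<close>
  have "\<exists>n c. color_connecting k G c \<and> card (c ` edges G) = n"
    using assms(4) by (auto simp: cc_exists_def)
  then have "\<exists>c. color_connecting k G c \<and> card (c ` edges G) = cc k G"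
    unfolding cc_def by (rule LeastI_ex)
  then obtain c where c: "color_connecting k G c" "card (c ` edges G) = cc k G" by blast
  obtain c' where c': "color_connecting k H c'" "c' ` edges H \<subseteq> c ` edges G"
    using color_connecting_subdivision[OF assms(5,2) c(1)] by blast
  have "cc k H \<le> card (c' ` edges H)"
    unfolding cc_def using c'(1) by (intro Least_le) blast
  \<comment> \<open>Finiteness of \<open>G\<close> matters here, because \<open>card\<close> of an
    infinite set is 0.\<close>
  also have "\<dots> \<le> card (c ` edges G)"
    using c'(2) G.pair_finite_arcs by (intro card_mono) (auto simp: edges_def)
  finally show ?thesis
    using c(2) c'(1) by (auto simp: cc_exists_def)
qed

end
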